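(* Let $n>3$. The dynamics group $G_{60}$ of Wolfram rule $60$ on the circular graph with $n$ vertices is isomorphic to $\mathrm{SL}_n(\mathbb{Z}_2)$, and its action on $\mathbb{F}_2^n$ fixes the all-zero state, with the remaining states forming a single orbit.
   Context: Indices are taken modulo $n$. For $1\le i\le n$ let $F_i\colon\mathbb{F}_2^n\to\mathbb{F}_2^n$ (the local update function of Wolfram rule $60$) be the map that replaces $y_i$ by $y_i+y_{i-1}\bmod 2$ and leaves all other coordinates unchanged. Each $F_i$ is a bijection, every state in $\mathbb{F}_2^n$ is periodic, and the dynamics group $G_{60}$ is the group of permutations of $\mathbb{F}_2^n$ generated by $F_1,\dots,F_n$. $\mathbb{Z}_2=\mathbb{Z}/2\mathbb{Z}$. *)

theory Defs
  imports
    "Jordan_Normal_Form.Determinant"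
    "HOL-Algebra.Group_Action"
    "HOL-Algebra.Generated_Groups"
    "HOL-Library.Z2"
begin

text \<open>
  States are vectors over the two-element field \<^typ>\<open>bit\<close>. Coordinates are indexed by
  \<open>0, ..., n - 1\<close> instead of \<open>1, ..., n\<close>, and \<open>(i + n - 1) mod n\<close> is the cyclic
  predecessor of the vertex \<open>i\<close> (the summand \<open>n\<close> avoids truncated subtraction at \<open>i = 0\<close>).
\<close>

abbreviation states :: "nat \<Rightarrow> bit vec set" where
  "states n \<equiv> carrier_vec n"

text \<open>
  The map is restricted to the states because \<^const>\<open>BijGroup\<close> consists of extensional functions.
\<close>

definition local_update_60 :: "nat \<Rightarrow> nat \<Rightarrow> bit vec \<Rightarrow> bit vec" where
  "local_update_60 n i = (\<lambda>y \<in> states n.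
     vec n (\<lambda>j. if j = i then y $ i + y $ ((i + n - 1) mod n) else y $ j))"

definition G60 :: "nat \<Rightarrow> (bit vec \<Rightarrow> bit vec) monoid" where
  "G60 n = (BijGroup (states n))
     \<lparr>carrier := generate (BijGroup (states n)) (local_update_60 n ` {..<n})\<rparr>"

definition SL :: "'a::comm_ring_1 itself \<Rightarrow> nat \<Rightarrow> 'a mat monoid" where
  "SL _ n = \<lparr>carrier = {A \<in> carrier_mat n n. det A = 1}, mult = (*), one = 1\<^sub>m n\<rparr>"

lemma local_update_60_involution:
  assumes "n > 1" "i < n" "y \<in> states n"
  shows "local_update_60 n i (local_update_60 n i y) = y"
proof -
  have ne: "(i + n - 1) mod n \<noteq> i"
  proof (cases "i = 0")
    case False
    have "(i - 1 + n) mod n = i - 1" using assms(2) by (simp only: mod_add_self2 mod_less less_imp_diff_less)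
    moreover have "i + n - 1 = i - 1 + n" using False by linarith
    ultimately have "(i + n - 1) mod n = i - 1" by (simp only:)
    then show ?thesis using False by simp
  qed (use assms(1) in simp)
  have lt: "(i + n - 1) mod n < n" using assms(1) by simp
  have cancel: "a + b + b = a" for a b :: bit
    by (cases a rule: bit.exhaust; cases b rule: bit.exhaust) simp_all
  show ?thesis
  proof (rule eq_vecI)
    fix j assume "j < dim_vec y"
    then show "local_update_60 n i (local_update_60 n i y) $ j = y $ j"
      using assms ne lt by (simp add: local_update_60_def cancel del: add_bit_eq_xor)
  qed (use assms in \<open>simp add: local_update_60_def\<close>)
qed

lemma local_update_60_in_BijGroup:
  assumes "n > 1" "i < n"
  shows "local_update_60 n i \<in> carrier (BijGroup (states n))"
proof -
  have "local_update_60 n i y \<in> states n" if "y \<in> states n" for y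
    using that by (simp add: local_update_60_def)
  then have "bij_betw (local_update_60 n i) (states n) (states n)"
    using local_update_60_involution[OF assms]
    by (intro bij_betw_byWitness[where f' = "local_update_60 n i"]) auto
  then show ?thesis by (simp add: BijGroup_def Bij_def local_update_60_def)
qed

lemma G60_subgroup:
  assumes "n > 1"
  shows "subgroup (carrier (G60 n)) (BijGroup (states n))"
proof -
  have "local_update_60 n ` {..<n} \<subseteq> carrier (BijGroup (states n))"
    using local_update_60_in_BijGroup[OF assms] by blast
  from group.generate_is_subgroup[OF group_BijGroup this] show ?thesis
    by (simp add: G60_def)
qed

lemma G60_action:
  assumes "n > 1"
  shows "group_action (G60 n) (states n) (\<lambda>g. g)"
proof -
  have eq: "G60 n = (BijGroup (states n))\<lparr>carrier := carrier (G60 n)\<rparr>"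
    by (simp add: G60_def)
  have "group (G60 n)"
    using subgroup.subgroup_is_group[OF G60_subgroup[OF assms] group_BijGroup]
    by (simp only: eq[symmetric])
  moreover have "(\<lambda>g. g) \<in> hom (G60 n) (BijGroup (states n))"
    using subgroup.subset[OF G60_subgroup[OF assms]] by (auto simp: hom_def G60_def)
  ultimately show ?thesis
    by (simp add: group_action_def group_hom_def group_hom_axioms_def group_BijGroup)
qed

lemma group_SL: "group (SL TYPE('a::comm_ring_1) n)"
proof (rule groupI)
  fix A :: "'a mat" assume A: "A \<in> carrier (SL TYPE('a) n)"
  then have C: "A \<in> carrier_mat n n" "det A = 1" by (auto simp: SL_def)
  note adj = adj_mat[OF C(1)]
  have inv: "adj_mat A * A = 1\<^sub>m n" using adj(3) C(2) by auto
  have "det (adj_mat A) * det A = 1"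
    using det_mult[OF adj(1) C(1)] inv by simp
  then have "det (adj_mat A) = 1" using C(2) by simp
  then show "\<exists>B \<in> carrier (SL TYPE('a) n). B \<otimes>\<^bsub>SL TYPE('a) n\<^esub> A = \<one>\<^bsub>SL TYPE('a) n\<^esub>"
    using adj(1) inv by (auto simp: SL_def)
qed (auto simp: SL_def det_mult)

end

theory Submission
  imports Defs
begin

text \<open>
  Each local update is linear: \<^term>\<open>local_update_60 n i\<close> is multiplication by the transvection
  that adds row \<open>i - 1\<close> to row \<open>i\<close> of the identity matrix. Matrices of determinant \<open>1\<close> act
  faithfully on column vectors, and a homomorphism sends a generated subgroup to the subgroup
  generated by the images. So \<^term>\<open>G60 n\<close> is the image of the subgroup \<open>K\<close> of
  \<open>SL\<^sub>n(\<int>/2)\<close> that the \<open>n\<close> cyclic transvections generate, and everything comes down to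
  showing that \<open>K\<close> is all of \<open>SL\<^sub>n(\<int>/2)\<close>.

  Write \<open>T i j = 1 + E i j\<close>, where \<open>E i j\<close> is the matrix unit. The commutator of \<open>T i j\<close>
  and \<open>T j k\<close> is \<open>T i k\<close> (\<open>transvection_commutator\<close>). Since the generators follow a directed
  cycle through all indices, walking along that cycle produces every transvection
  (\<open>cyclic_transvections_suffice\<close>).
  Gaussian elimination with transvections as row operations then reduces any matrix of determinant
  \<open>1\<close> to the identity (\<open>transvection_group.SL_mem_by_elimination\<close>). Transvections
  suffice as row operations because over \<open>\<int>/2\<close> a nonzero pivot is \<open>1\<close>, and a zero pivot is
  repaired by adding another row.

  The first elimination step alone moves any nonzero vector to the first unit vector, so the nonzero
  states form a single orbit; the zero state is fixed because the action is linear.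
\<close>

section \<open>Transvections over the two-element field\<close>

abbreviation transvection :: "nat \<Rightarrow> nat \<Rightarrow> nat \<Rightarrow> bit mat" where
  "transvection n i j \<equiv> addrow_mat n 1 i j"

lemma SL_simps [simp]:
  "A \<in> carrier (SL TYPE('a::comm_ring_1) n) \<longleftrightarrow> A \<in> carrier_mat n n \<and> det A = 1"
  "A \<otimes>\<^bsub>SL TYPE('a) n\<^esub> B = A * B"
  "\<one>\<^bsub>SL TYPE('a) n\<^esub> = 1\<^sub>m n"
  by (auto simp: SL_def)

lemma addrow_mat_mult_vec:
  assumes "v \<in> carrier_vec n" "j < n"
  shows "addrow_mat n a i j *\<^sub>v v = vec n (\<lambda>r. if r = i then a * v $ j + v $ i else v $ r)"
proof (rule eq_vecI)
  fix r assume "r < dim_vec (vec n (\<lambda>r. if r = i then a * v $ j + v $ i else v $ r))"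
  then show "(addrow_mat n a i j *\<^sub>v v) $ r = vec n (\<lambda>r. if r = i then a * v $ j + v $ i else v $ r) $ r"
    using assms by (cases "r = i")
      (auto simp: row_addrow add_scalar_prod_distrib[of _ n] smult_scalar_prod_distrib[of _ n])
qed simp

lemma transvection_mult_vec:
  assumes "v \<in> states n" "j < n"
  shows "transvection n i j *\<^sub>v v = vec n (\<lambda>r. if r = i then v $ i + v $ j else v $ r)"
  using assms by (auto simp: addrow_mat_mult_vec add.commute simp del: add_bit_eq_xor mult_bit_eq_and)

lemma transvection_in_SL:
  "i \<noteq> j \<Longrightarrow> transvection n i j \<in> carrier (SL TYPE(bit) n)"
  by (simp add: det_addrow_mat)

lemma mult_mat_unit_vec_index:
  fixes A :: "'a::semiring_1 mat"
  assumes "A \<in> carrier_mat n m" "i < n" "j < m"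
  shows "(A *\<^sub>v unit_vec m j) $ i = A $$ (i, j)"
  using assms by auto

lemma mat_eq_by_unit_vecs:
  fixes A B :: "'a::semiring_1 mat"
  assumes "A \<in> carrier_mat n m" "B \<in> carrier_mat n m"
    and "\<And>j. j < m \<Longrightarrow> A *\<^sub>v unit_vec m j = B *\<^sub>v unit_vec m j"
  shows "A = B"
proof (rule eq_matI)
  fix i j assume "i < dim_row B" "j < dim_col B"
  then show "A $$ (i, j) = B $$ (i, j)"
    using assms by (metis carrier_matD mult_mat_unit_vec_index)
qed (use assms in auto)

text \<open>
  In characteristic \<open>2\<close> transvections are involutions, so the square on the left is the commutator
  of the two factors. Put \<open>N = E i j + E j k + E i k\<close>, with \<open>E\<close> the matrix units; the product of
  the two transvections is \<open>1 + N\<close>, and its square is \<open>1 + 2 N + N\<^sup>2 = 1 + E i k\<close>.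
\<close>

lemma transvection_commutator:
  assumes "i < n" "j < n" "k < n" "i \<noteq> j" "j \<noteq> k" "i \<noteq> k"
  shows "(transvection n i j * transvection n j k) * (transvection n i j * transvection n j k)
    = transvection n i k"
proof (rule mat_eq_by_unit_vecs[of _ n n])
  fix l assume "l < n"
  have cancel: "a + (b + (b + c)) = a + c" for a b c :: bit
    by (cases a; cases b; cases c; simp)
  have "(transvection n i j *\<^sub>v (transvection n j k *\<^sub>v (transvection n i j *\<^sub>v
      (transvection n j k *\<^sub>v v)))) = transvection n i k *\<^sub>v v" if "v \<in> states n" for v
    using assms that
    by (intro eq_vecI) (auto simp: transvection_mult_vec add.assoc cancel simp del: add_bit_eq_xor)
  then show "transvection n i j * transvection n j k * (transvection n i j * transvection n j k)
      *\<^sub>v unit_vec n l = transvection n i k *\<^sub>v unit_vec n l"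
    by (simp add: assoc_mult_mat_vec[of _ n n _ n] mult_carrier_mat[of _ n n _ n]
        mult_mat_vec_carrier[of _ n n])
qed (auto intro!: mult_carrier_mat[of _ n n _ n])

section \<open>Elimination inside a group containing all transvections\<close>

lemma SL_mult_vec_inject:
  fixes A :: "'a::comm_ring_1 mat"
  assumes "A \<in> carrier (SL TYPE('a) n)" "v \<in> carrier_vec n" "w \<in> carrier_vec n"
    and "A *\<^sub>v v = A *\<^sub>v w"
  shows "v = w"
proof -
  interpret SL: group "SL TYPE('a) n" by (rule group_SL)
  obtain B where B: "B \<in> carrier_mat n n" "B * A = 1\<^sub>m n"
    using SL.l_inv[OF assms(1)] SL.inv_closed[OF assms(1)] by (auto simp del: SL.l_inv SL.inv_closed)
  have "B *\<^sub>v (A *\<^sub>v u) = u" if "u \<in> carrier_vec n" for u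
    using that B assms(1) by (simp flip: assoc_mult_mat_vec[of _ n n _ n])
  then show ?thesis using assms(2-4) by metis
qed

lemma mult_mat_vec_fixes_span:
  fixes A :: "'a::semiring_1 mat"
  assumes A: "A \<in> carrier_mat n n" and v: "v \<in> carrier_vec n"
    and fixed: "\<And>j. j < n \<Longrightarrow> v $ j \<noteq> 0 \<Longrightarrow> A *\<^sub>v unit_vec n j = unit_vec n j"
  shows "A *\<^sub>v v = v"
proof (rule eq_vecI)
  fix i assume "i < dim_vec v"
  then have i: "i < n" using v by simp
  have "(A *\<^sub>v v) $ i = (\<Sum>j = 0..<n. A $$ (i, j) * v $ j)"
    using A v i by (simp add: scalar_prod_def)
  also have "\<dots> = (\<Sum>j = 0..<n. if i = j then v $ j else 0)"
  proof (rule sum.cong)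
    fix j assume "j \<in> {0..<n}"
    then have "A $$ (i, j) = (if i = j then 1 else 0)" if "v $ j \<noteq> 0"
      using fixed[of j] that mult_mat_unit_vec_index[OF A i, of j] i by auto
    then show "A $$ (i, j) * v $ j = (if i = j then v $ j else 0)"
      by (cases "v $ j = 0") (simp_all del: bit_not_zero_iff)
  qed simp
  finally show "(A *\<^sub>v v) $ i = v $ i" using i by simp
qed (use A v in auto)

text \<open>
  Elimination is carried out for an abstract subgroup \<open>K\<close> because it serves twice: with \<open>K\<close> the
  subgroup generated by the cyclic transvections it shows that \<open>K\<close> is the whole special linear
  group, and with \<open>K\<close> the special linear group itself it yields transitivity on nonzero vectors.
\<close>

locale transvection_group =
  fixes n :: nat and K :: "bit mat set"
  assumes subgroup: "subgroup K (SL TYPE(bit) n)"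
    and transvection_mem: "\<And>i j. i < n \<Longrightarrow> j < n \<Longrightarrow> i \<noteq> j \<Longrightarrow> transvection n i j \<in> K"
begin

lemma mem_carrier: "A \<in> K \<Longrightarrow> A \<in> carrier_mat n n"
  using subgroup.subset[OF subgroup] by auto

lemma mult_mem: "A \<in> K \<Longrightarrow> B \<in> K \<Longrightarrow> A * B \<in> K"
  using subgroup.m_closed[OF subgroup] by auto

lemma one_mem: "1\<^sub>m n \<in> K"
  using subgroup.one_closed[OF subgroup] by auto

lemma mult_vec:
  "A \<in> K \<Longrightarrow> B \<in> K \<Longrightarrow> v \<in> states n \<Longrightarrow> (A * B) *\<^sub>v v = A *\<^sub>v (B *\<^sub>v v)"
  by (metis assoc_mult_mat_vec mem_carrier)

lemma transvection_unit_vec: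
  assumes "k < n" "j < n" "j \<noteq> k"
  shows "transvection n i k *\<^sub>v unit_vec n j = unit_vec n j"
  using assms by (intro eq_vecI) (auto simp: transvection_mult_vec)

text \<open>
  Row operations that subtract the pivot row \<open>k\<close> from other rows change a column only if its
  entry \<open>k\<close> is nonzero. This is why the other unit vectors survive, and with them the columns
  that elimination has already reduced.
\<close>

lemma clear_entries:
  assumes v: "v \<in> states n" and k: "k < n" "v $ k = 1" and S: "finite S" "S \<subseteq> {..<n} - {k}"
  shows "\<exists>A\<in>K. (\<forall>j<n. j \<noteq> k \<longrightarrow> A *\<^sub>v unit_vec n j = unit_vec n j)
    \<and> A *\<^sub>v v = vec n (\<lambda>i. if i \<in> S then 0 else v $ i)"
  using S
proof (induction S)
  case empty
  show ?case using v by (intro bexI[OF _ one_mem]) auto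
next
  case (insert i S)
  then obtain A where A: "A \<in> K" "\<And>j. j < n \<Longrightarrow> j \<noteq> k \<Longrightarrow> A *\<^sub>v unit_vec n j = unit_vec n j"
    and Av: "A *\<^sub>v v = vec n (\<lambda>i. if i \<in> S then 0 else v $ i)" by auto
  have i: "i < n" "i \<noteq> k" "k \<notin> S" using insert.prems by auto
  show ?case
  proof (cases "v $ i = 0")
    case True
    then have "A *\<^sub>v v = vec n (\<lambda>j. if j \<in> insert i S then 0 else v $ j)"
      using Av by (auto intro!: eq_vecI)
    then show ?thesis using A by blast
  next
    case False
    let ?T = "transvection n i k"
    have T: "?T \<in> K" using transvection_mem i k by blast
    have "?T *\<^sub>v (A *\<^sub>v v) = vec n (\<lambda>j. if j \<in> insert i S then 0 else v $ j)"
      unfolding Av using i k False insert.hyps by (intro eq_vecI) (auto simp: transvection_mult_vec)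
    then have "(?T * A) *\<^sub>v v = vec n (\<lambda>j. if j \<in> insert i S then 0 else v $ j)"
      using mult_vec T A(1) v by simp
    moreover have "(?T * A) *\<^sub>v unit_vec n j = unit_vec n j" if "j < n" "j \<noteq> k" for j
      using mult_vec T A that transvection_unit_vec k by simp
    ultimately show ?thesis using mult_mem[OF T A(1)] by blast
  qed
qed

text \<open>
  Only rows from \<open>k\<close> on may supply a pivot: adding row \<open>i\<close> to row \<open>k\<close> with \<open>i < k\<close> would disturb
  the unit vector \<open>i\<close>. With \<open>k = 0\<close> there is no such restriction, and the lemma moves every nonzero
  vector to the first unit vector.
\<close>

lemma move_to_unit_vec:
  assumes v: "v \<in> states n" and i: "i < n" "k \<le> i" "v $ i \<noteq> 0"
  shows "\<exists>A\<in>K. (\<forall>j<k. A *\<^sub>v unit_vec n j = unit_vec n j) \<and> A *\<^sub>v v = unit_vec n k"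
proof -
  have k: "k < n" using i by simp
  have pivot: "\<exists>A\<in>K. (\<forall>j<k. A *\<^sub>v unit_vec n j = unit_vec n j) \<and> A *\<^sub>v w = unit_vec n k"
    if w: "w \<in> states n" "w $ k = 1" for w
  proof -
    obtain A where A: "A \<in> K" "\<And>j. j < n \<Longrightarrow> j \<noteq> k \<Longrightarrow> A *\<^sub>v unit_vec n j = unit_vec n j"
      "A *\<^sub>v w = vec n (\<lambda>i. if i \<in> {..<n} - {k} then 0 else w $ i)"
      using clear_entries[OF w(1) k w(2), of "{..<n} - {k}"] by auto
    have "A *\<^sub>v w = unit_vec n k" unfolding A(3) using w k by (intro eq_vecI) (auto simp: unit_vec_def)
    then show ?thesis using A(1,2) k by (intro bexI[of _ A] conjI allI impI) simp_all
  qed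
  show ?thesis
  proof (cases "v $ k = 0")
    case False
    then show ?thesis using pivot v by simp
  next
    case True
    then have ne: "k \<noteq> i" using i by auto
    \<comment> \<open>Adding the nonzero entry \<open>i\<close> to the zero entry \<open>k\<close> creates the pivot.\<close>
    let ?T = "transvection n k i"
    have T: "?T \<in> K" using transvection_mem i k ne by blast
    have "(?T *\<^sub>v v) $ k = 1" using v i k True by (simp add: transvection_mult_vec)
    moreover have "?T *\<^sub>v v \<in> states n" by (rule mult_mat_vec_carrier[OF mem_carrier[OF T] v])
    ultimately obtain A where A: "A \<in> K" "\<And>j. j < k \<Longrightarrow> A *\<^sub>v unit_vec n j = unit_vec n j"
      "A *\<^sub>v (?T *\<^sub>v v) = unit_vec n k"
      using pivot by blast
    have "(A * ?T) *\<^sub>v unit_vec n j = unit_vec n j" if "j < k" for j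
      using mult_vec[OF A(1) T] A(2) that k i transvection_unit_vec by simp
    then show ?thesis using mult_mem[OF A(1) T] mult_vec[OF A(1) T v] A(3) by auto
  qed
qed

text \<open>
  Descending induction on the number \<open>k\<close> of columns already equal to those of the identity. A pivot
  at or below row \<open>k\<close> exists in column \<open>k\<close>: otherwise that column would be a combination of the
  first \<open>k\<close> unit vectors, hence fixed by the matrix, which would send two different vectors, the
  column and the unit vector \<open>k\<close>, to the same image.
\<close>

lemma SL_mem_by_elimination:
  assumes "k \<le> n" "A \<in> carrier (SL TYPE(bit) n)"
    and "\<And>j. j < k \<Longrightarrow> A *\<^sub>v unit_vec n j = unit_vec n j"
  shows "A \<in> K"
  using assms
proof (induction arbitrary: A rule: inc_induct)
  case base
  then have "A = 1\<^sub>m n" by (intro mat_eq_by_unit_vecs[of _ n n]) auto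
  then show ?case using one_mem by simp
next
  case (step k)
  interpret SL: group "SL TYPE(bit) n" by (rule group_SL)
  have Ac: "A \<in> carrier_mat n n" using step.prems by simp
  define v where "v = A *\<^sub>v unit_vec n k"
  have v: "v \<in> states n" unfolding v_def using Ac by simp
  have "\<exists>i<n. k \<le> i \<and> v $ i \<noteq> 0"
  proof (rule ccontr)
    assume "\<not> ?thesis"
    then have zero: "v $ i = 0" if "i < n" "k \<le> i" for i using that by blast
    have "A *\<^sub>v v = v"
      using step.prems(2) zero by (intro mult_mat_vec_fixes_span[OF Ac v]) (metis not_le)
    then have "v = unit_vec n k"
      using SL_mult_vec_inject[OF step.prems(1) v] v_def by simp
    then show False using zero[of k] step.hyps by simp
  qed
  then obtain B where B: "B \<in> K" "\<And>j. j < k \<Longrightarrow> B *\<^sub>v unit_vec n j = unit_vec n j"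
    "B *\<^sub>v v = unit_vec n k"
    using move_to_unit_vec[OF v] by blast
  have BSL: "B \<in> carrier (SL TYPE(bit) n)" using subgroup.subset[OF subgroup] B(1) by blast
  have "B * A \<in> K"
  proof (rule step.IH)
    show "B * A \<in> carrier (SL TYPE(bit) n)" using SL.m_closed[OF BSL step.prems(1)] by simp
    fix j assume "j < Suc k"
    then show "B * A *\<^sub>v unit_vec n j = unit_vec n j"
      using B step.prems(2) v_def by (cases "j = k")
        (simp_all add: assoc_mult_mat_vec[OF mem_carrier[OF B(1)] Ac])
  qed
  then have "inv\<^bsub>SL TYPE(bit) n\<^esub> B * (B * A) \<in> K"
    using mult_mem subgroup.m_inv_closed[OF subgroup B(1)] by blast
  then show ?case
    using SL.inv_solve_left[of A B "B * A"] step.prems(1) BSL SL.m_closed[OF BSL step.prems(1)]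
    by (metis SL_simps(2))
qed

lemma eq_SL: "K = carrier (SL TYPE(bit) n)"
  using SL_mem_by_elimination[of 0] subgroup.subset[OF subgroup] by auto

end

section \<open>Generation by the cyclic transvections\<close>

text \<open>
  Induction on the cyclic distance \<open>d\<close> from \<open>j\<close> to \<open>i\<close>: the commutator with the generator that leads
  from the index at distance \<open>d\<close> to its successor extends the distance by one. The three indices
  involved stay distinct as long as the new distance is less than \<open>n\<close>.
\<close>

lemma cyclic_transvections_suffice:
  assumes "subgroup K (SL TYPE(bit) n)"
    and gen: "\<And>i. i < n \<Longrightarrow> transvection n i ((i + n - 1) mod n) \<in> K"
  shows "transvection_group n K"
proof (rule transvection_group.intro)
  have shift: "(a + d) mod n \<noteq> (a + e) mod n" if "d < e" "e < n + d" for a d e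
  proof
    assume "(a + d) mod n = (a + e) mod n"
    then have "n dvd (a + e) - (a + d)" using that(1) by (intro mod_eq_dvd_iff_nat[THEN iffD1]) auto
    then show False using that by (auto dest: dvd_imp_le)
  qed
  have mult: "A \<in> K \<Longrightarrow> B \<in> K \<Longrightarrow> A * B \<in> K" for A B
    using subgroup.m_closed[OF assms(1)] by auto
  have steps: "transvection n ((b + d) mod n) b \<in> K" if "0 < d" "d < n" "b < n" for b d
    using that
  proof (induction d)
    case (Suc d)
    let ?i = "(b + Suc d) mod n" and ?j = "(b + d) mod n"
    have pred: "(?i + n - 1) mod n = ?j"
    proof -
      have "(?i + n - 1) mod n = (?i + (n - 1)) mod n" using Suc.prems by simp
      also have "\<dots> = (b + Suc d + (n - 1)) mod n" by (simp only: mod_add_left_eq)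
      also have "b + Suc d + (n - 1) = b + d + n" using Suc.prems by simp
      finally show ?thesis by simp
    qed
    have Tij: "transvection n ?i ?j \<in> K" using gen[of ?i] pred Suc.prems by simp
    show ?case
    proof (cases "d = 0")
      case True
      then show ?thesis using Tij Suc.prems by simp
    next
      case False
      then have Tjb: "transvection n ?j b \<in> K" using Suc by simp
      have "?i \<noteq> ?j" "?j \<noteq> b" "?i \<noteq> b"
        using shift[of d "Suc d" b] shift[of 0 d b] shift[of 0 "Suc d" b] False Suc.prems by auto
      then have "transvection n ?i b
          = (transvection n ?i ?j * transvection n ?j b) * (transvection n ?i ?j * transvection n ?j b)"
        using Suc.prems by (intro transvection_commutator[symmetric]) auto
      then show ?thesis using mult Tij Tjb by simp
    qed
  qed simp
  show "transvection n i j \<in> K" if "i < n" "j < n" "i \<noteq> j" for i j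
  proof (cases "j < i")
    case True
    then show ?thesis using steps[of "i - j" j] that by simp
  next
    case False
    then show ?thesis using steps[of "i + n - j" j] that by simp
  qed
qed (rule assms(1))

lemma predecessor_neq:
  fixes n i :: nat
  assumes "n > 1" "i < n"
  shows "(i + n - 1) mod n \<noteq> i"
proof (cases i)
  case (Suc m)
  then have "i + n - 1 = m + n" by simp
  then show ?thesis using assms Suc by simp
qed (use assms in simp)

lemma SL_generated_by_cyclic_transvections:
  assumes "n > 1"
  shows "generate (SL TYPE(bit) n) ((\<lambda>i. transvection n i ((i + n - 1) mod n)) ` {..<n})
    = carrier (SL TYPE(bit) n)" (is "generate ?G ?X = _")
proof -
  interpret SL: group ?G by (rule group_SL)
  have "?X \<subseteq> carrier ?G"
    using predecessor_neq[OF assms] transvection_in_SL by (metis (no_types, lifting) image_subsetI lessThan_iff)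
  then have "subgroup (generate ?G ?X) ?G" by (rule SL.generate_is_subgroup)
  then interpret transvection_group n "generate ?G ?X"
    by (rule cyclic_transvections_suffice) (auto intro: generate.incl)
  show ?thesis by (rule eq_SL)
qed

section \<open>The dynamics group as a linear group\<close>

text \<open>
  Elements of \<^const>\<open>BijGroup\<close> are extensional, so equality with the local updates requires the value
  \<^const>\<open>undefined\<close> outside the state space.
\<close>

definition mat_action :: "nat \<Rightarrow> bit mat \<Rightarrow> bit vec \<Rightarrow> bit vec" where
  "mat_action n A = (\<lambda>v \<in> states n. A *\<^sub>v v)"

lemma mat_action_Bij:
  assumes A: "A \<in> carrier (SL TYPE(bit) n)"
  shows "mat_action n A \<in> Bij (states n)"
proof -
  interpret SL: group "SL TYPE(bit) n" by (rule group_SL)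
  obtain B where B: "B \<in> carrier_mat n n" "A * B = 1\<^sub>m n"
    using SL.r_inv[OF A] SL.inv_closed[OF A] by (auto simp del: SL.r_inv SL.inv_closed)
  have "v \<in> (*\<^sub>v) A ` states n" if "v \<in> states n" for v
    using that B A by (intro image_eqI[of _ _ "B *\<^sub>v v"]) (simp_all flip: assoc_mult_mat_vec[of _ n n _ n])
  moreover have "(*\<^sub>v) A ` states n \<subseteq> states n" using A by auto
  moreover have "inj_on ((*\<^sub>v) A) (states n)" using SL_mult_vec_inject[OF A] by (intro inj_onI)
  ultimately have "bij_betw ((*\<^sub>v) A) (states n) (states n)"
    by (auto simp: bij_betw_def)
  then show ?thesis by (simp add: Bij_def mat_action_def)
qed

lemma mat_action_hom: "group_hom (SL TYPE(bit) n) (BijGroup (states n)) (mat_action n)"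
proof -
  have "mat_action n (A * B) = compose (states n) (mat_action n A) (mat_action n B)"
    if "A \<in> carrier_mat n n" "B \<in> carrier_mat n n" for A B
    using that by (auto simp: mat_action_def compose_def fun_eq_iff assoc_mult_mat_vec[of _ n n _ n])
  then show ?thesis
    using mat_action_Bij
    by (intro group_hom.intro group_hom_axioms.intro group_SL group_BijGroup)
      (auto simp: hom_def BijGroup_def)
qed

lemma mat_action_inj: "inj_on (mat_action n) (carrier (SL TYPE(bit) n))"
proof (rule inj_onI)
  fix A B assume AB: "A \<in> carrier (SL TYPE(bit) n)" "B \<in> carrier (SL TYPE(bit) n)"
    and eq: "mat_action n A = mat_action n B"
  show "A = B"
  proof (rule mat_eq_by_unit_vecs)
    show "A *\<^sub>v unit_vec n j = B *\<^sub>v unit_vec n j" for j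
      using fun_cong[OF eq, of "unit_vec n j"] by (simp add: mat_action_def)
  qed (use AB in auto)
qed

lemma mat_action_transvection:
  assumes "i < n"
  shows "mat_action n (transvection n i ((i + n - 1) mod n)) = local_update_60 n i"
  using assms
  by (auto simp: mat_action_def local_update_60_def fun_eq_iff transvection_mult_vec
      simp del: add_bit_eq_xor)

lemma carrier_G60:
  assumes "n > 1"
  shows "carrier (G60 n) = mat_action n ` carrier (SL TYPE(bit) n)"
proof -
  let ?T = "\<lambda>i. transvection n i ((i + n - 1) mod n)"
  interpret group_hom "SL TYPE(bit) n" "BijGroup (states n)" "mat_action n" by (rule mat_action_hom)
  have "local_update_60 n ` {..<n} = mat_action n ` ?T ` {..<n}"
    unfolding image_image by (intro image_cong mat_action_transvection[symmetric]) auto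
  moreover have "?T ` {..<n} \<subseteq> carrier (SL TYPE(bit) n)"
    using predecessor_neq[OF assms] transvection_in_SL by (metis (no_types, lifting) image_subsetI lessThan_iff)
  ultimately show ?thesis
    using generate_img SL_generated_by_cyclic_transvections[OF assms] by (simp add: G60_def)
qed

lemma G60_iso_SL:
  assumes "n > 1"
  shows "G60 n \<cong> SL TYPE(bit) n"
proof -
  interpret SL: group "SL TYPE(bit) n" by (rule group_SL)
  interpret group_hom "SL TYPE(bit) n" "BijGroup (states n)" "mat_action n" by (rule mat_action_hom)
  have "mat_action n \<in> iso (SL TYPE(bit) n) (G60 n)"
    using homh mat_action_inj carrier_G60[OF assms]
    by (simp add: Group.iso_iff hom_def Pi_def) (simp add: G60_def)
  then show ?thesis using SL.iso_sym is_isoI by blast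
qed

lemma SL_transitive:
  assumes v: "v \<in> states n" "v \<noteq> 0\<^sub>v n" and w: "w \<in> states n" "w \<noteq> 0\<^sub>v n"
  shows "\<exists>A\<in>carrier (SL TYPE(bit) n). A *\<^sub>v v = w"
proof -
  interpret SL: group "SL TYPE(bit) n" by (rule group_SL)
  interpret transvection_group n "carrier (SL TYPE(bit) n)"
    by (intro transvection_group.intro SL.subgroup_self transvection_in_SL)
  have reduce: "\<exists>A\<in>carrier (SL TYPE(bit) n). A *\<^sub>v u = unit_vec n 0"
    if u: "u \<in> states n" "u \<noteq> 0\<^sub>v n" for u
  proof -
    have "\<exists>i<n. u $ i \<noteq> 0" using u by (metis carrier_vecD eq_vecI index_zero_vec)
    then show ?thesis using move_to_unit_vec[OF u(1), of _ 0] by auto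
  qed
  obtain A where A: "A \<in> carrier (SL TYPE(bit) n)" "A *\<^sub>v v = unit_vec n 0" using reduce[OF v] by blast
  obtain B where B: "B \<in> carrier (SL TYPE(bit) n)" "B *\<^sub>v w = unit_vec n 0" using reduce[OF w] by blast
  define C where "C = inv\<^bsub>SL TYPE(bit) n\<^esub> B"
  have C: "C \<in> carrier (SL TYPE(bit) n)" "C * B = 1\<^sub>m n"
    using SL.l_inv[OF B(1)] SL.inv_closed[OF B(1)] by (simp_all add: C_def del: SL.l_inv SL.inv_closed)
  have "(C * A) *\<^sub>v v = (C * B) *\<^sub>v w"
    using mult_vec[OF C(1) A(1) v(1)] mult_vec[OF C(1) B(1) w(1)] A(2) B(2) by simp
  then show ?thesis using mult_mem[OF C(1) A(1)] C(2) w(1) by auto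
qed

theorem mainTheorem8:
  fixes n :: nat
  assumes "n > 3"
  shows "G60 n \<cong> SL TYPE(bit) n
    \<and> (\<forall>g \<in> carrier (G60 n). g (0\<^sub>v n) = 0\<^sub>v n)
    \<and> orbits (G60 n) (states n) (\<lambda>g. g) = {{0\<^sub>v n}, states n - {0\<^sub>v n}}"
proof (intro conjI)
  have n: "n > 1" using assms by simp
  let ?G = "SL TYPE(bit) n"
  interpret SL: group ?G by (rule group_SL)
  show "G60 n \<cong> ?G" by (rule G60_iso_SL[OF n])
  have A_zero: "A *\<^sub>v 0\<^sub>v n = 0\<^sub>v n" if "A \<in> carrier ?G" for A
    using that by auto
  then show "\<forall>g \<in> carrier (G60 n). g (0\<^sub>v n) = 0\<^sub>v n"
    by (simp add: carrier_G60[OF n] mat_action_def del: SL_simps)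
  have orbit: "orbit (G60 n) (\<lambda>g. g) v = (\<lambda>A. A *\<^sub>v v) ` carrier ?G" if "v \<in> states n" for v
    using that unfolding orbit_def carrier_G60[OF n] Setcompr_eq_image image_image
    by (simp add: mat_action_def)
  have orbit_zero: "orbit (G60 n) (\<lambda>g. g) (0\<^sub>v n) = {0\<^sub>v n}"
    using A_zero SL.one_closed by (auto simp: orbit simp del: SL_simps)
  have orbit_nonzero: "orbit (G60 n) (\<lambda>g. g) v = states n - {0\<^sub>v n}"
    if v: "v \<in> states n" "v \<noteq> 0\<^sub>v n" for v
  proof -
    have "A *\<^sub>v v \<in> states n - {0\<^sub>v n}" if A: "A \<in> carrier ?G" for A
      using SL_mult_vec_inject[OF A v(1), of "0\<^sub>v n"] A_zero[OF A] v A by auto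
    then show ?thesis
      using SL_transitive[OF v] by (auto simp: orbit[OF v(1)] image_iff simp del: SL_simps)
  qed
  have "unit_vec n 0 \<in> states n - {0\<^sub>v n}" using n by simp
  then show "orbits (G60 n) (states n) (\<lambda>g. g) = {{0\<^sub>v n}, states n - {0\<^sub>v n}}"
    using orbit_zero orbit_nonzero unfolding orbits_def by (auto simp del: unit_vec_carrier)
qed

end
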